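(* Let $G$ be a finite simple graph with combinatorial Laplacian $L$, and let $k \ge 1$ be an integer. Then the integer $\det(1 + kL)$ is the number of rooted $k$-colored spanning forests contained in $G$.
   Context: For a finite simple graph $G$ with vertex set $V$, $|V|=n$, the combinatorial Laplacian is the $n\times n$ matrix $L = D - A$, where $A$ is the adjacency matrix and $D$ is the diagonal matrix of vertex degrees; equivalently $L = C^T C$, where $C$ is the (oriented) incidence matrix ("gradient") with rows indexed by edges and columns indexed by vertices. In $\det(1+kL)$, $1$ denotes the $n\times n$ identity matrix. A spanning forest in $G$ is a subgraph with vertex set all of $V$, whose edges are edges of $G$, and which contains no cycles; its connected components are trees, and a tree consisting of a single vertex (a "seed") is allowed. A rooted spanning forest is a spanning forest together with a choice of one vertex (the root) in each of its connected components. A rooted $k$-colored spanning forest is a rooted spanning forest together with an assignment of one of $k$ colors to each of its edges (an arbitrary assignment, with no properness condition). Two rooted $k$-colored spanning forests are counted as the same only if they have the same edges, the same roots and the same edge colors (vertices are labeled; no identification up to isomorphism). *)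

theory Defs
  imports "Jordan_Normal_Form.Determinant" "HOL-Library.FuncSet"
begin

text \<open>Edges are unordered pairs, represented as two-element sets of vertices.\<close>

definition simple_graph :: "'a set \<Rightarrow> 'a set set \<Rightarrow> bool" where
  "simple_graph V E \<longleftrightarrow> finite V \<and> (\<forall>e\<in>E. e \<subseteq> V \<and> card e = 2)"

definition vertex_degree :: "'a set set \<Rightarrow> 'a \<Rightarrow> nat" where
  "vertex_degree E v = card {e \<in> E. v \<in> e}"

text \<open>The list \<open>vs\<close> enumerates the vertices without repetition; rows and columns are indexed by
  positions in \<open>vs\<close>.  If \<open>i = j\<close>, then \<open>{vs ! i, vs ! j}\<close> is a singleton, hence not an edge.\<close>

definition adjacency_mat :: "'a list \<Rightarrow> 'a set set \<Rightarrow> int mat" where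
  "adjacency_mat vs E =
     mat (length vs) (length vs) (\<lambda>(i, j). if {vs ! i, vs ! j} \<in> E then 1 else 0)"

definition degree_mat :: "'a list \<Rightarrow> 'a set set \<Rightarrow> int mat" where
  "degree_mat vs E =
     mat (length vs) (length vs) (\<lambda>(i, j). if i = j then int (vertex_degree E (vs ! i)) else 0)"

definition laplacian :: "'a list \<Rightarrow> 'a set set \<Rightarrow> int mat" where
  "laplacian vs E = degree_mat vs E - adjacency_mat vs E"

text \<open>A cycle is listed by its vertices \<open>p\<^sub>0, \<dots>, p\<^sub>m\<close> (the start is not repeated at the end),
  with at least three of them; the last one is adjacent to the first.\<close>

definition is_cycle :: "'a set set \<Rightarrow> 'a list \<Rightarrow> bool" where
  "is_cycle F p \<longleftrightarrow> 3 \<le> length p \<and> distinct p \<and>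
     (\<forall>i < length p. {p ! i, p ! (Suc i mod length p)} \<in> F)"

text \<open>A spanning subgraph has all of \<open>V\<close> as vertices, so it is given by its edge set \<open>F\<close>.\<close>

definition spanning_forest :: "'a set set \<Rightarrow> 'a set set \<Rightarrow> bool" where
  "spanning_forest E F \<longleftrightarrow> F \<subseteq> E \<and> (\<nexists>p. is_cycle F p)"

definition graph_components :: "'a set \<Rightarrow> 'a set set \<Rightarrow> 'a set set" where
  "graph_components V F = {{w \<in> V. (v, w) \<in> {(x, y). {x, y} \<in> F}\<^sup>*} | v. v \<in> V}"

text \<open>A choice of one vertex in each component is recorded by the set \<open>R\<close> of chosen vertices;
  components are disjoint, so \<open>R\<close> determines the choice.\<close>

definition root_set :: "'a set \<Rightarrow> 'a set set \<Rightarrow> 'a set \<Rightarrow> bool" where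
  "root_set V F R \<longleftrightarrow> R \<subseteq> V \<and> (\<forall>C \<in> graph_components V F. \<exists>!r. r \<in> C \<and> r \<in> R)"

text \<open>Colorings are extensional functions, so that distinct triples are distinct colored forests.\<close>

definition rooted_colored_spanning_forests ::
  "'a set \<Rightarrow> 'a set set \<Rightarrow> nat \<Rightarrow> ('a set set \<times> 'a set \<times> ('a set \<Rightarrow> nat)) set" where
  "rooted_colored_spanning_forests V E k =
     {(F, R, c). spanning_forest E F \<and> root_set V F R \<and> c \<in> F \<rightarrow>\<^sub>E {..<k}}"

end

theory Submission
  imports Defs
begin

text \<open>
  Row \<open>v\<close> of \<open>1 + kL\<close> is the sum of \<open>e\<^sub>v\<close> and of \<open>k (e\<^sub>v - e\<^sub>u)\<close> over the neighbours \<open>u\<close> of \<open>v\<close>.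
  Expanding the determinant multilinearly in the rows gives a sum over all maps \<open>f\<close> sending each
  vertex to itself (a root) or to a neighbour (its parent).  If iterating \<open>f\<close> from some vertex never
  reaches a root, the indicator of all such vertices is in the kernel of the corresponding matrix,
  so its determinant is 0; otherwise the matrix is triangular for the distance to the root and
  its determinant is \<open>k\<close> to the number of non-roots.  The maps of the second kind are
  the rooted spanning forests, with edges \<open>{v, f v}\<close>.
\<close>

section \<open>Parent maps and their matrices\<close>

text \<open>The choice \<open>u = v\<close> stands for the identity summand of row \<open>v\<close>,
  a choice \<open>u \<noteq> v\<close> for the edge from \<open>v\<close> to \<open>u\<close>.
  Arguments are vertices rather than positions, so sums over positions can be reindexed over
  \<open>set vs\<close>.\<close>

definition parent_row :: "int \<Rightarrow> 'a \<Rightarrow> 'a \<Rightarrow> 'a \<Rightarrow> int" where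
  "parent_row k v u w = (if u = v then of_bool (w = v) else k * (of_bool (w = v) - of_bool (w = u)))"

definition parent_mat :: "'a list \<Rightarrow> int \<Rightarrow> ('a \<Rightarrow> 'a) \<Rightarrow> int mat" where
  "parent_mat vs k f =
     mat (length vs) (length vs) (\<lambda>(i, j). parent_row k (vs ! i) (f (vs ! i)) (vs ! j))"

definition parent_choices :: "'a set set \<Rightarrow> 'a \<Rightarrow> 'a set" where
  "parent_choices E v = insert v {u. {v, u} \<in> E}"

text \<open>Says that \<open>f\<close> has no cycles in \<open>V\<close> other than fixed points.
  The witness \<open>d\<close> drives both the inductions towards the roots and the triangularity of
  the matrix.\<close>

definition ranked :: "'a set \<Rightarrow> ('a \<Rightarrow> 'a) \<Rightarrow> bool" where
  "ranked V f \<longleftrightarrow> (\<exists>d::'a \<Rightarrow> nat. \<forall>v\<in>V. f v \<noteq> v \<longrightarrow> d (f v) < d v)"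

definition parent_edges :: "'a set \<Rightarrow> ('a \<Rightarrow> 'a) \<Rightarrow> 'a set set" where
  "parent_edges V f = {{v, f v} |v. v \<in> V \<and> f v \<noteq> v}"

definition parent_roots :: "'a set \<Rightarrow> ('a \<Rightarrow> 'a) \<Rightarrow> 'a set" where
  "parent_roots V f = {v \<in> V. f v = v}"

section \<open>Multilinear expansion of a determinant in its rows\<close>

lemma permutes_upt_less: "p permutes {0..<n} \<Longrightarrow> i < n \<Longrightarrow> p i < n" for n :: nat
  using permutes_in_image[of p "{0..<n}" i] by simp

text \<open>In the Leibniz formula every permutation contributes a product over the rows of sums,
  which distributes into a sum over choice functions; exchanging the two outer sums gives the
  claim.\<close>

lemma det_mat_row_sums:
  fixes m :: "'a \<Rightarrow> 'b \<Rightarrow> 'a \<Rightarrow> 'c::comm_ring_1"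
  assumes "distinct vs" and fin: "\<And>v. v \<in> set vs \<Longrightarrow> finite (B v)"
  defines "n \<equiv> length vs"
  shows "det (mat n n (\<lambda>(i, j). \<Sum>u\<in>B (vs ! i). m (vs ! i) u (vs ! j)))
    = (\<Sum>f\<in>PiE (set vs) B. det (mat n n (\<lambda>(i, j). m (vs ! i) (f (vs ! i)) (vs ! j))))"
proof -
  have bij: "bij_betw ((!) vs) {0..<n} (set vs)"
    using assms(1) unfolding n_def by (simp add: bij_betw_nth lessThan_atLeast0)
  have swap: "(\<Prod>i = 0..<n. \<Sum>u\<in>B (vs ! i). m (vs ! i) u (vs ! p i))
      = (\<Sum>f\<in>PiE (set vs) B. \<Prod>i = 0..<n. m (vs ! i) (f (vs ! i)) (vs ! p i))" for p
  proof -
    \<comment> \<open>A permutation acts on positions while the choice functions act on vertices;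
      \<open>q\<close> is the column vertex seen from the row vertex.\<close>
    define q where "q v = vs ! p (inv_into {0..<n} ((!) vs) v)" for v
    have q: "q (vs ! i) = vs ! p i" if "i \<in> {0..<n}" for i
      using bij that by (simp add: q_def bij_betw_def inv_into_f_f)
    have "(\<Prod>i = 0..<n. \<Sum>u\<in>B (vs ! i). m (vs ! i) u (vs ! p i))
        = (\<Prod>i = 0..<n. \<Sum>u\<in>B (vs ! i). m (vs ! i) u (q (vs ! i)))"
      by (rule prod.cong) (simp_all add: q)
    also have "\<dots> = (\<Prod>v\<in>set vs. \<Sum>u\<in>B v. m v u (q v))"
      by (rule prod.reindex_bij_betw[OF bij])
    also have "\<dots> = (\<Sum>f\<in>PiE (set vs) B. \<Prod>v\<in>set vs. m v (f v) (q v))"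
      by (rule prod_sum_PiE) (simp_all add: fin)
    also have "\<dots> = (\<Sum>f\<in>PiE (set vs) B. \<Prod>i = 0..<n. m (vs ! i) (f (vs ! i)) (q (vs ! i)))"
      by (intro sum.cong refl prod.reindex_bij_betw[OF bij, symmetric])
    also have "\<dots> = (\<Sum>f\<in>PiE (set vs) B. \<Prod>i = 0..<n. m (vs ! i) (f (vs ! i)) (vs ! p i))"
      by (intro sum.cong prod.cong) (simp_all add: q)
    finally show ?thesis .
  qed
  let ?P = "{p. p permutes {0..<n}}"
  have "det (mat n n (\<lambda>(i, j). \<Sum>u\<in>B (vs ! i). m (vs ! i) u (vs ! j)))
      = (\<Sum>p\<in>?P. signof p * (\<Prod>i = 0..<n. \<Sum>u\<in>B (vs ! i). m (vs ! i) u (vs ! p i)))"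
    by (subst det_def'[of _ n]) (auto intro!: sum.cong prod.cong simp: permutes_upt_less)
  also have "\<dots> = (\<Sum>f\<in>PiE (set vs) B. \<Sum>p\<in>?P.
      signof p * (\<Prod>i = 0..<n. m (vs ! i) (f (vs ! i)) (vs ! p i)))"
    by (simp add: swap sum_distrib_left sum.swap[of _ ?P])
  also have "\<dots> = (\<Sum>f\<in>PiE (set vs) B. det (mat n n (\<lambda>(i, j). m (vs ! i) (f (vs ! i)) (vs ! j))))"
    by (rule sum.cong[OF refl], subst det_def'[of _ n])
      (auto intro!: sum.cong prod.cong simp: permutes_upt_less)
  finally show ?thesis .
qed

section \<open>Rows of 1 + kL as sums over parent choices\<close>

lemma finite_edges: "simple_graph V E \<Longrightarrow> finite E"
  unfolding simple_graph_def by (meson Pow_iff finite_Pow_iff finite_subset subsetI)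

lemma parent_choices_subset: "simple_graph V E \<Longrightarrow> v \<in> V \<Longrightarrow> parent_choices E v \<subseteq> V"
  unfolding simple_graph_def parent_choices_def by auto

lemma finite_parent_choices: "simple_graph V E \<Longrightarrow> v \<in> V \<Longrightarrow> finite (parent_choices E v)"
  using parent_choices_subset finite_subset unfolding simple_graph_def by metis

lemma vertex_degree_eq_card_neighbours:
  assumes "simple_graph V E"
  shows "vertex_degree E v = card {u. {v, u} \<in> E}"
proof -
  have "bij_betw (\<lambda>u. {v, u}) {u. {v, u} \<in> E} {e \<in> E. v \<in> e}"
    unfolding bij_betw_def
  proof
    show "inj_on (\<lambda>u. {v, u}) {u. {v, u} \<in> E}" by (auto simp: inj_on_def doubleton_eq_iff)
    have "\<exists>u. e = {v, u}" if "e \<in> E" "v \<in> e" for e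
      using assms that unfolding simple_graph_def by (metis card_2_iff insert_iff singletonD insert_commute)
    then show "(\<lambda>u. {v, u}) ` {u. {v, u} \<in> E} = {e \<in> E. v \<in> e}" by auto
  qed
  then show ?thesis unfolding vertex_degree_def by (simp add: bij_betw_same_card)
qed

lemma no_loop: "simple_graph V E \<Longrightarrow> {v, v} \<notin> E"
  unfolding simple_graph_def by force

text \<open>The right side is the entry of 1 + kL in row \<open>v\<close> and column
  \<open>w\<close>. Each neighbour adds \<open>k\<close> on the diagonal, which yields the degree,
  and \<open>-k\<close> in its own column.\<close>

lemma sum_parent_row:
  assumes "simple_graph V E" "v \<in> V"
  shows "(\<Sum>u\<in>parent_choices E v. parent_row k v u w)
    = of_bool (v = w) + k * ((if v = w then int (vertex_degree E v) else 0) - of_bool ({v, w} \<in> E))"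
proof -
  let ?N = "{u. {v, u} \<in> E}"
  have fin: "finite ?N"
    using finite_parent_choices[OF assms] by (simp add: parent_choices_def)
  have "v \<notin> ?N" using no_loop[OF assms(1)] by simp
  then have "(\<Sum>u\<in>parent_choices E v. parent_row k v u w)
      = of_bool (v = w) + (\<Sum>u\<in>?N. k * (of_bool (v = w) - of_bool (w = u)))"
    unfolding parent_choices_def using fin
    by (subst sum.insert) (auto simp: parent_row_def intro!: sum.cong)
  also have "(\<Sum>u\<in>?N. k * (of_bool (v = w) - of_bool (w = u)))
      = k * (int (card ?N) * of_bool (v = w) - (\<Sum>u\<in>?N. of_bool (w = u)))"
    by (simp add: sum_distrib_left[symmetric] sum_subtractf)
  also have "(\<Sum>u\<in>?N. of_bool (w = u)) = (of_bool ({v, w} \<in> E) :: int)"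
    using fin by (simp add: of_bool_def sum.delta')
  finally show ?thesis
    by (simp add: vertex_degree_eq_card_neighbours[OF assms(1)])
qed

lemma det_one_plus_laplacian:
  assumes "simple_graph V E" "distinct vs" "set vs = V"
  shows "det (1\<^sub>m (length vs) + k \<cdot>\<^sub>m laplacian vs E)
    = (\<Sum>f\<in>PiE V (parent_choices E). det (parent_mat vs k f))"
proof -
  have "1\<^sub>m (length vs) + k \<cdot>\<^sub>m laplacian vs E = mat (length vs) (length vs)
      (\<lambda>(i, j). \<Sum>u\<in>parent_choices E (vs ! i). parent_row k (vs ! i) u (vs ! j))"
    using assms
    by (intro eq_matI) (auto simp: laplacian_def degree_mat_def adjacency_mat_def
        sum_parent_row[OF assms(1)] nth_eq_iff_index_eq of_bool_def)
  then show ?thesis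
    unfolding parent_mat_def using det_mat_row_sums[of vs "parent_choices E" "parent_row k"] assms
    by (simp add: finite_parent_choices)
qed

section \<open>Determinant of a single parent map\<close>

text \<open>Instead of reordering the rows by rank, the proof shows that only the identity survives
  in the Leibniz formula. The diagonal has \<open>k\<close> at non-roots and 1 at roots.\<close>

lemma det_parent_mat_ranked:
  assumes "distinct vs" "ranked (set vs) f"
  shows "det (parent_mat vs k f) = k ^ card {v \<in> set vs. f v \<noteq> v}"
proof -
  let ?n = "length vs"
  let ?m = "\<lambda>i j. parent_row k (vs ! i) (f (vs ! i)) (vs ! j)"
  obtain d :: "'a \<Rightarrow> nat" where d: "\<And>v. v \<in> set vs \<Longrightarrow> f v \<noteq> v \<Longrightarrow> d (f v) < d v"
    using assms(2) unfolding ranked_def by blast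
  \<comment> \<open>A permutation with nonzero product never raises the rank, and preserves the sum of the ranks.\<close>
  have id: "p = id" if p: "p permutes {0..<?n}" and nz: "(\<Prod>i = 0..<?n. ?m i (p i)) \<noteq> 0" for p
  proof -
    have step: "p i = i \<or> d (vs ! p i) < d (vs ! i)" if "i \<in> {0..<?n}" for i
    proof -
      have pi: "p i < ?n" using permutes_upt_less[OF p] that by simp
      have "?m i (p i) \<noteq> 0" using nz that by auto
      then have "vs ! p i = vs ! i \<or> vs ! p i = f (vs ! i) \<and> f (vs ! i) \<noteq> vs ! i"
        by (auto simp: parent_row_def split: if_splits)
      then show ?thesis
        using that pi assms(1) d[of "vs ! i"] by (auto simp: nth_eq_iff_index_eq)
    qed
    have "(\<Sum>i = 0..<?n. d (vs ! p i)) = (\<Sum>i = 0..<?n. d (vs ! i))"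
      using sum.permute[OF p, of "\<lambda>i. d (vs ! i)"] by (simp add: o_def)
    then have "\<not> d (vs ! p i) < d (vs ! i)" if "i \<in> {0..<?n}" for i
      using sum_strict_mono_ex1[of "{0..<?n}" "\<lambda>i. d (vs ! p i)" "\<lambda>i. d (vs ! i)"] step that
      by (metis finite_atLeastLessThan less_imp_le_nat less_irrefl order_refl)
    then have "p i = i" for i
      using step p by (metis permutes_not_in)
    then show ?thesis by auto
  qed
  have bij: "bij_betw ((!) vs) {0..<?n} (set vs)"
    using assms(1) by (simp add: bij_betw_nth lessThan_atLeast0)
  have "det (parent_mat vs k f)
      = (\<Sum>p\<in>{p. p permutes {0..<?n}}. signof p * (\<Prod>i = 0..<?n. ?m i (p i)))"
    unfolding parent_mat_def
    by (subst det_def'[of _ ?n]) (auto intro!: sum.cong prod.cong simp: permutes_upt_less)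
  also have "\<dots> = (\<Sum>p\<in>{id}. signof p * (\<Prod>i = 0..<?n. ?m i (p i)))"
    by (rule sum.mono_neutral_right) (auto simp: finite_permutations permutes_id dest!: id)
  also have "\<dots> = (\<Prod>i = 0..<?n. ?m i i)" by simp
  also have "\<dots> = (\<Prod>v\<in>set vs. parent_row k v (f v) v)"
    by (rule prod.reindex_bij_betw[OF bij])
  also have "\<dots> = (\<Prod>v\<in>set vs. if f v \<noteq> v then k else 1)"
    by (rule prod.cong) (auto simp: parent_row_def)
  also have "\<dots> = k ^ card {v \<in> set vs. f v \<noteq> v}"
    by (simp add: prod.If_cases Int_def)
  finally show ?thesis .
qed

text \<open>The number of steps to the first fixed point serves as rank: it drops at every step to a
  parent.\<close>

lemma ranked_if_all_reach_root:
  assumes "\<And>v. v \<in> V \<Longrightarrow> \<exists>n. f ((f ^^ n) v) = (f ^^ n) v" and "f \<in> V \<rightarrow> V"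
  shows "ranked V f"
proof -
  define d where "d v = (LEAST n. f ((f ^^ n) v) = (f ^^ n) v)" for v
  have "d (f v) < d v" if "v \<in> V" "f v \<noteq> v" for v
  proof -
    have *: "f ((f ^^ d v) v) = (f ^^ d v) v"
      unfolding d_def using assms(1)[OF that(1)] by (rule LeastI_ex)
    with that have "d v \<noteq> 0" by (metis funpow_0)
    then obtain m where m: "d v = Suc m" by (cases "d v") auto
    with * have "f ((f ^^ m) (f v)) = (f ^^ m) (f v)" by (simp add: funpow_swap1)
    then have "d (f v) \<le> m" unfolding d_def by (rule Least_le)
    with m show ?thesis by simp
  qed
  then show ?thesis unfolding ranked_def by blast
qed

text \<open>Let \<open>U\<close> be the set of vertices that never reach a root. Roots lie outside
  \<open>U\<close>, and any other vertex lies in \<open>U\<close> exactly if its parent does, so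
  every row annihilates the indicator of \<open>U\<close>, which is nonzero.\<close>

lemma det_parent_mat_not_ranked:
  assumes "distinct vs" "\<not> ranked (set vs) f" and maps: "f \<in> set vs \<rightarrow> set vs"
  shows "det (parent_mat vs k f) = 0"
proof -
  let ?n = "length vs"
  define U where "U = {v \<in> set vs. \<forall>n. f ((f ^^ n) v) \<noteq> (f ^^ n) v}"
  obtain v where v: "v \<in> U"
    using assms(2) ranked_if_all_reach_root[OF _ maps] unfolding U_def by blast
  have U_step: "v \<in> U \<longleftrightarrow> f v \<noteq> v \<and> f v \<in> U" if "v \<in> set vs" for v
  proof
    assume "v \<in> U"
    then have *: "f ((f ^^ n) v) \<noteq> (f ^^ n) v" for n unfolding U_def by blast
    have "f v \<noteq> v" using *[of 0] by simp
    moreover have "f ((f ^^ n) (f v)) \<noteq> (f ^^ n) (f v)" for n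
      using *[of "Suc n"] by (simp add: funpow_swap1)
    ultimately show "f v \<noteq> v \<and> f v \<in> U" using funcset_mem[OF maps that] unfolding U_def by blast
  next
    assume R: "f v \<noteq> v \<and> f v \<in> U"
    have "f ((f ^^ n) v) \<noteq> (f ^^ n) v" for n
    proof (cases n)
      case (Suc m)
      then show ?thesis using R unfolding U_def by (auto simp: funpow_swap1)
    qed (use R in simp)
    then show "v \<in> U" using that unfolding U_def by blast
  qed
  define x :: "int vec" where "x = vec ?n (\<lambda>i. of_bool (vs ! i \<in> U))"
  have bij: "bij_betw ((!) vs) {0..<?n} (set vs)"
    using assms(1) by (simp add: bij_betw_nth lessThan_atLeast0)
  have "parent_mat vs k f *\<^sub>v x = 0\<^sub>v ?n"
  proof (rule eq_vecI)
    fix i assume "i < dim_vec (0\<^sub>v ?n :: int vec)"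
    then have i: "i < ?n" by simp
    let ?v = "vs ! i"
    have v: "?v \<in> set vs" using i by simp
    have "(parent_mat vs k f *\<^sub>v x) $ i
        = (\<Sum>j = 0..<?n. parent_row k ?v (f ?v) (vs ! j) * of_bool (vs ! j \<in> U))"
      using i by (simp add: parent_mat_def x_def scalar_prod_def)
    also have "\<dots> = (\<Sum>w\<in>set vs. parent_row k ?v (f ?v) w * of_bool (w \<in> U))"
      by (rule sum.reindex_bij_betw[OF bij])
    also have "\<dots> = 0"
    proof (cases "f ?v = ?v")
      case True
      then have "?v \<notin> U" using U_step[OF v] by simp
      with True show ?thesis by (auto simp: parent_row_def intro!: sum.neutral)
    next
      case False
      have "(\<Sum>w\<in>set vs. parent_row k ?v (f ?v) w * of_bool (w \<in> U))
          = k * ((\<Sum>w\<in>set vs. if w = ?v then of_bool (w \<in> U) else 0)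
               - (\<Sum>w\<in>set vs. if w = f ?v then of_bool (w \<in> U) else 0))"
        unfolding sum_subtractf[symmetric] sum_distrib_left using False
        by (intro sum.cong) (auto simp: parent_row_def)
      also have "\<dots> = k * (of_bool (?v \<in> U) - of_bool (f ?v \<in> U))"
        using v funcset_mem[OF maps v] by (simp add: sum.delta)
      finally show ?thesis using U_step[OF v] False by simp
    qed
    finally show "(parent_mat vs k f *\<^sub>v x) $ i = 0\<^sub>v ?n $ i" using i by simp
  qed (simp add: parent_mat_def)
  moreover obtain i where "i < ?n" "vs ! i = v"
    using v unfolding U_def by (auto simp: in_set_conv_nth)
  then have "x $ i \<noteq> 0\<^sub>v ?n $ i" using v by (simp add: x_def)
  then have "x \<noteq> 0\<^sub>v ?n" by auto
  moreover have "x \<in> carrier_vec ?n" by (simp add: x_def)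
  moreover have "parent_mat vs k f \<in> carrier_mat ?n ?n" by (simp add: parent_mat_def)
  ultimately show ?thesis using det_0_iff_vec_prod_zero by blast
qed

section \<open>From ranked parent maps to rooted forests\<close>

text \<open>Two non-roots give the same edge only if each is the parent of the other, and then each
  would have smaller rank than the other.\<close>

lemma card_parent_edges:
  assumes "ranked V f"
  shows "card (parent_edges V f) = card {v \<in> V. f v \<noteq> v}"
proof -
  have "inj_on (\<lambda>v. {v, f v}) {v \<in> V. f v \<noteq> v}"
    using assms unfolding ranked_def inj_on_def
    by (metis (mono_tags, lifting) doubleton_eq_iff less_asym mem_Collect_eq)
  moreover have "parent_edges V f = (\<lambda>v. {v, f v}) ` {v \<in> V. f v \<noteq> v}"
    unfolding parent_edges_def by auto
  ultimately show ?thesis by (simp add: card_image)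
qed

lemma parent_edges_acyclic:
  assumes "ranked V f"
  shows "\<not> is_cycle (parent_edges V f) p"
proof
  assume cyc: "is_cycle (parent_edges V f) p"
  obtain d :: "'a \<Rightarrow> nat" where d: "\<And>v. v \<in> V \<Longrightarrow> f v \<noteq> v \<Longrightarrow> d (f v) < d v"
    using assms unfolding ranked_def by blast
  let ?n = "length p"
  have n: "3 \<le> ?n" and dist: "distinct p"
    and edge: "\<And>i. i < ?n \<Longrightarrow> {p ! i, p ! (Suc i mod ?n)} \<in> parent_edges V f"
    using cyc unfolding is_cycle_def by auto
  \<comment> \<open>Both neighbours on the cycle of a vertex of maximal rank would be its parent.\<close>
  have "Max (d ` set p) \<in> d ` set p" using n by (intro Max_in) auto
  then obtain i where i: "i < ?n" and "d (p ! i) = Max (d ` set p)"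
    by (auto simp: in_set_conv_nth)
  then have max: "d w \<le> d (p ! i)" if "w \<in> set p" for w
    using that by simp
  \<comment> \<open>If the edge came from \<open>w\<close> instead, then \<open>p ! i\<close> would
    be the parent of \<open>w\<close> and have smaller rank, against maximality.\<close>
  have parent: "w = f (p ! i)" if "{p ! i, w} \<in> parent_edges V f" "w \<in> set p" for w
    using that max[OF that(2)] d unfolding parent_edges_def by (fastforce simp: doubleton_eq_iff)
  \<comment> \<open>The predecessor of \<open>i\<close> on the cycle, wrapping around at 0. With at
    least three vertices it differs from the successor.\<close>
  define j where "j = (if i = 0 then ?n - 1 else i - 1)"
  have j: "j < ?n" "Suc j mod ?n = i" using i n by (auto simp: j_def)
  have s: "Suc i mod ?n < ?n" using n by (intro mod_less_divisor) linarith
  have "p ! (Suc i mod ?n) = f (p ! i)" using edge[OF i] s by (intro parent) auto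
  moreover have "p ! j = f (p ! i)"
    using edge[OF j(1)] j by (intro parent) (auto simp: insert_commute)
  ultimately have "Suc i mod ?n = j" using dist s j(1) by (metis nth_eq_iff_index_eq)
  then show False using i n by (auto simp: j_def mod_Suc split: if_splits)
qed

lemma ranked_reaches_root:
  assumes "ranked V f" "f \<in> V \<rightarrow> V" "v \<in> V"
  shows "\<exists>n. (f ^^ n) v \<in> parent_roots V f"
proof -
  obtain d :: "'a \<Rightarrow> nat" where d: "\<And>v. v \<in> V \<Longrightarrow> f v \<noteq> v \<Longrightarrow> d (f v) < d v"
    using assms unfolding ranked_def by blast
  show ?thesis using assms(3)
  proof (induction "d v" arbitrary: v rule: less_induct)
    case less
    show ?case
    proof (cases "f v = v")
      case True
      then show ?thesis using less.prems by (auto simp: parent_roots_def intro!: exI[of _ 0])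
    next
      case False
      then obtain n where "(f ^^ n) (f v) \<in> parent_roots V f"
        using less d assms(2) by blast
      then have "(f ^^ Suc n) v \<in> parent_roots V f" by (simp add: funpow_swap1)
      then show ?thesis by blast
    qed
  qed
qed

lemma funpow_in: "f \<in> V \<rightarrow> V \<Longrightarrow> v \<in> V \<Longrightarrow> (f ^^ n) v \<in> V"
  by (induction n) auto

text \<open>Stated for any \<open>F\<close> containing the parent edges, since it also serves while
  only one inclusion between a given forest and the parent edges is known.\<close>

lemma funpow_connected:
  assumes "parent_edges V f \<subseteq> F" "f \<in> V \<rightarrow> V" "v \<in> V"
  shows "(v, (f ^^ n) v) \<in> {(x, y). {x, y} \<in> F}\<^sup>*"
proof (induction n)
  case (Suc n)
  have "(f ^^ n) v \<in> V" using funpow_in[OF assms(2,3)] .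
  then have "f ((f ^^ n) v) = (f ^^ n) v \<or> {(f ^^ n) v, f ((f ^^ n) v)} \<in> F"
    using assms(1) unfolding parent_edges_def by blast
  then show ?case using Suc by (auto intro: rtrancl_into_rtrancl)
qed simp

text \<open>Iterating \<open>f\<close> leads to a root inside the component. It is the only one,
  because crossing a parent edge in either direction does not change the root that is eventually
  reached.\<close>

lemma root_set_parent_roots:
  assumes "ranked V f" and maps: "f \<in> V \<rightarrow> V"
  shows "root_set V (parent_edges V f) (parent_roots V f)"
proof -
  let ?rel = "{(x, y). {x, y} \<in> parent_edges V f}"
  have stable: "(f ^^ m) v = (f ^^ n) v"
    if "f ((f ^^ m) v) = (f ^^ m) v" "f ((f ^^ n) v) = (f ^^ n) v" for m n :: nat and v
  proof -
    have "(f ^^ l) w = w" if "f w = w" for l :: nat and w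
      using that by (induction l) auto
    with that have "(f ^^ (m + n)) v = (f ^^ n) v" "(f ^^ (n + m)) v = (f ^^ m) v"
      by (simp_all add: funpow_add)
    then show ?thesis by (simp add: add.commute)
  qed
  have connected: "\<exists>n. (f ^^ n) v = r"
    if "(v, r) \<in> ?rel\<^sup>*" "f r = r" for v r
    using that
  proof (induction rule: converse_rtrancl_induct)
    case base
    show ?case by (rule exI[of _ 0]) simp
  next
    case (step v w)
    then obtain n where n: "(f ^^ n) w = r" by blast
    have "w = f v \<or> v = f w"
      using step(1) unfolding parent_edges_def by (auto simp: doubleton_eq_iff)
    then show ?case
    proof
      assume "w = f v"
      then have "(f ^^ Suc n) v = r" using n by (simp add: funpow_swap1)
      then show ?thesis by blast
    next
      \<comment> \<open>The same \<open>n\<close> works: starting one step further along the orbit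
        ends in \<open>f r\<close>, which is \<open>r\<close>.\<close>
      assume "v = f w"
      then have "(f ^^ n) v = r" using n \<open>f r = r\<close> by (simp add: funpow_swap1[symmetric])
      then show ?thesis by blast
    qed
  qed
  have "\<exists>!r. r \<in> C \<and> r \<in> parent_roots V f" if C_comp: "C \<in> graph_components V (parent_edges V f)" for C
  proof -
    obtain v where v: "v \<in> V" and C: "C = {w \<in> V. (v, w) \<in> ?rel\<^sup>*}"
      using C_comp unfolding graph_components_def by blast
    obtain n where n: "(f ^^ n) v \<in> parent_roots V f"
      using ranked_reaches_root[OF assms v] by blast
    show ?thesis
    proof (rule ex1I)
      show "(f ^^ n) v \<in> C \<and> (f ^^ n) v \<in> parent_roots V f"
        using n v funpow_connected[OF subset_refl maps v, of n] funpow_in[OF maps v, of n]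
        by (simp add: C)
    next
      fix r assume "r \<in> C \<and> r \<in> parent_roots V f"
      then have r: "(v, r) \<in> ?rel\<^sup>*" "f r = r" by (auto simp: C parent_roots_def)
      then obtain m where "(f ^^ m) v = r" using connected by blast
      then show "r = (f ^^ n) v" using r n stable[of m v n] by (simp add: parent_roots_def)
    qed
  qed
  then show ?thesis unfolding root_set_def by (auto simp: parent_roots_def)
qed

section \<open>Recovering the parent map from the rooted forest\<close>

text \<open>By induction on the rank under \<open>f\<close>. The edge from \<open>v\<close> to
  \<open>f v\<close> must also arise from \<open>g\<close>; were it as the parent edge of
  \<open>f v\<close>, the induction hypothesis would give \<open>f (f v) = v\<close>, and the rank
  would increase again.\<close>

lemma parent_map_unique:
  assumes "ranked V f" and maps: "f \<in> V \<rightarrow> V"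
    and edges: "parent_edges V f = parent_edges V g"
    and roots: "parent_roots V f = parent_roots V g"
    and "v \<in> V"
  shows "f v = g v"
proof -
  obtain d :: "'a \<Rightarrow> nat" where d: "\<And>v. v \<in> V \<Longrightarrow> f v \<noteq> v \<Longrightarrow> d (f v) < d v"
    using assms unfolding ranked_def by blast
  show ?thesis using assms(5)
  proof (induction "d v" arbitrary: v rule: less_induct)
    case less
    show ?case
    proof (cases "f v = v")
      case True
      then have "v \<in> parent_roots V g" using roots less.prems by (auto simp: parent_roots_def)
      then show ?thesis using True by (simp add: parent_roots_def)
    next
      case False
      have lt: "d (f v) < d v" using d less.prems False by blast
      have IH: "f (f v) = g (f v)" using less lt funcset_mem[OF maps] by blast
      have "{v, f v} \<in> parent_edges V g"
        using False less.prems edges unfolding parent_edges_def by blast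
      then consider "f v = g v" | "g (f v) = v"
        unfolding parent_edges_def by (auto simp: doubleton_eq_iff)
      then show ?thesis
      proof cases
        case 2
        then have "f (f v) = v" using IH by simp
        then have "d v < d (f v)" using d[of "f v"] funcset_mem[OF maps less.prems] False by auto
        then show ?thesis using lt by simp
      qed
    qed
  qed
qed

text \<open>Follow the parents of both ends of an edge up to their first common ancestor.\<close>

lemma extra_edge_closes_cycle:
  assumes sub: "parent_edges V f \<subseteq> F" and maps: "f \<in> V \<rightarrow> V"
    and xy: "x \<in> V" "y \<in> V" "x \<noteq> y" "{x, y} \<in> F" "{x, y} \<notin> parent_edges V f"
    and meet: "(f ^^ a) x = (f ^^ b) y"
  shows "\<exists>p. is_cycle F p"
proof -
  \<comment> \<open>The first point on the path from \<open>x\<close> that lies on the orbit of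
    \<open>y\<close>; below, \<open>j\<close> is the first time at which \<open>y\<close> gets
    there.\<close>
  define i where "i = (LEAST a. \<exists>b. (f ^^ a) x = (f ^^ b) y)"
  have "\<exists>b. (f ^^ i) x = (f ^^ b) y"
    unfolding i_def by (rule LeastI_ex) (use meet in blast)
  define j where "j = (LEAST b. (f ^^ i) x = (f ^^ b) y)"
  have ij: "(f ^^ i) x = (f ^^ j) y"
    unfolding j_def by (rule LeastI_ex) fact
  have min_i: "(f ^^ a) x \<noteq> (f ^^ b) y" if "a < i" for a b
    using not_less_Least[OF that[unfolded i_def]] by blast
  have min_j: "(f ^^ i) x \<noteq> (f ^^ b) y" if "b < j" for b
    using not_less_Least[OF that[unfolded j_def]] by blast
  have shift: "(f ^^ (a + c)) z = (f ^^ (b + c)) z" if "(f ^^ a) z = (f ^^ b) z" for a b c and z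
    using that by (simp add: funpow_add add.commute[of _ c])
  \<comment> \<open>A repetition on the path would allow a shortcut to the meeting point, against
    the minimality of \<open>i\<close>; likewise for \<open>y\<close> and \<open>j\<close>.\<close>
  have inj_x: "(f ^^ a) x \<noteq> (f ^^ b) x" if "a < b" "b \<le> i" for a b
    using shift[of a x b "i - b"] min_i[of "a + (i - b)" j] ij that by auto
  have inj_y: "(f ^^ a) y \<noteq> (f ^^ b) y" if "a < b" "b \<le> j" for a b
    using shift[of a y b "j - b"] min_j[of "a + (j - b)"] ij that
    by (metis add_less_mono1 le_add_diff_inverse)
  \<comment> \<open>The vertices of the cycle: from \<open>x\<close> at position 0 up to the common
    ancestor at position \<open>i\<close>, then down to \<open>y\<close> at position
    \<open>i + j\<close>. The edge \<open>{x, y}\<close> closes it.\<close>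
  define q where "q a = (if a \<le> i then (f ^^ a) x else (f ^^ (i + j - a)) y)" for a
  have q_y: "q a = (f ^^ (i + j - a)) y" if "i \<le> a" for a
    using that ij by (auto simp: q_def)
  have q_neq: "q a \<noteq> q b" if "a < b" "b \<le> i + j" for a b
  proof -
    consider "b \<le> i" | "a < i" "i < b" | "i \<le> a" using that by linarith
    then show ?thesis
    proof cases
      case 1
      then show ?thesis using that inj_x by (simp add: q_def)
    next
      case 2
      then show ?thesis using min_i by (simp add: q_def)
    next
      case 3
      then show ?thesis
        using that inj_y[of "i + j - b" "i + j - a", symmetric] by (simp add: q_y)
    qed
  qed
  have f_edge: "{z, f z} \<in> F" if "z \<in> V" "f z \<noteq> z" for z
    using sub that unfolding parent_edges_def by blast
  have q_edge: "{q a, q (Suc a)} \<in> F" if "a < i + j" for a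
  proof (cases "a < i")
    case True
    then show ?thesis
      using inj_x[of a "Suc a"] f_edge[of "(f ^^ a) x"] funpow_in[OF maps xy(1), of a]
      by (auto simp: q_def)
  next
    case False
    define c where "c = i + j - Suc a"
    have c: "Suc c \<le> j" "i + j - a = Suc c" using False that by (auto simp: c_def)
    have "q a = f ((f ^^ c) y)" "q (Suc a) = (f ^^ c) y"
      using False c by (simp_all add: q_y c_def[symmetric])
    then show ?thesis
      using inj_y[of c "Suc c"] c f_edge[of "(f ^^ c) y"] funpow_in[OF maps xy(2), of c]
      by (auto simp: insert_commute)
  qed
  have "i + j \<noteq> 0"
  proof
    assume "i + j = 0"
    then have "i = 0" "j = 0" by simp_all
    then show False using ij xy(3) by simp
  qed
  \<comment> \<open>Otherwise one of \<open>x\<close> and \<open>y\<close> is the parent of the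
    other, and \<open>{x, y}\<close> is a parent edge. This secures the third vertex of the
    cycle.\<close>
  moreover have "i + j \<noteq> 1"
  proof
    assume "i + j = 1"
    then have "i = 1 \<and> j = 0 \<or> i = 0 \<and> j = 1" by linarith
    then have "f x = y \<or> f y = x" using ij by auto
    then show False
      using xy unfolding parent_edges_def by (auto simp: doubleton_eq_iff)
  qed
  ultimately have "3 \<le> Suc (i + j)" by linarith
  moreover have "distinct (map q [0..<Suc (i + j)])"
    unfolding distinct_map inj_on_def using q_neq
    by (auto simp del: upt_Suc) (metis less_Suc_eq_le linorder_neqE_nat)
  moreover have "{map q [0..<Suc (i + j)] ! a, map q [0..<Suc (i + j)] ! (Suc a mod Suc (i + j))} \<in> F"
    if "a < Suc (i + j)" for a
  proof (cases "a = i + j")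
    case True
    then show ?thesis
      using xy(4) by (simp add: q_y q_def[of 0] insert_commute del: upt_Suc)
  next
    case False
    then show ?thesis using that q_edge[of a] by (simp del: upt_Suc)
  qed
  ultimately show ?thesis unfolding is_cycle_def
    by (intro exI[of _ "map q [0..<Suc (i + j)]"]) (simp del: upt_Suc)
qed

text \<open>Edges are oriented towards the roots: the parent of a non-root is a neighbour in
  \<open>F\<close> at smaller distance from \<open>R\<close>. No edge of \<open>F\<close> is left
  over, since such an edge would close a cycle.\<close>

lemma exists_parent_map:
  assumes graph: "simple_graph V E" and forest: "spanning_forest E F" and roots: "root_set V F R"
  shows "\<exists>f\<in>PiE V (parent_choices E). ranked V f \<and> parent_edges V f = F \<and> parent_roots V f = R"
proof -
  let ?rel = "{(x, y). {x, y} \<in> F}"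
  have FE: "F \<subseteq> E" and acyclic: "\<not> is_cycle F p" for p
    using forest unfolding spanning_forest_def by auto
  have FV: "e \<subseteq> V" "card e = 2" if "e \<in> F" for e
    using that FE graph unfolding simple_graph_def by auto
  have RV: "R \<subseteq> V" using roots unfolding root_set_def by simp
  have root_ex1: "\<exists>!r. r \<in> C \<and> r \<in> R" if "C \<in> graph_components V F" for C
    using roots that unfolding root_set_def by simp
  have unique_root: "\<exists>!r. r \<in> V \<and> (v, r) \<in> ?rel\<^sup>* \<and> r \<in> R" if "v \<in> V" for v
  proof -
    have "{w \<in> V. (v, w) \<in> ?rel\<^sup>*} \<in> graph_components V F"
      unfolding graph_components_def using that by blast
    then have "\<exists>!r. r \<in> {w \<in> V. (v, w) \<in> ?rel\<^sup>*} \<and> r \<in> R"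
      by (rule root_ex1)
    then show ?thesis by (simp add: conj_assoc)
  qed
  \<comment> \<open>The distance in \<open>F\<close> from \<open>v\<close> to the nearest element of
    \<open>R\<close>.\<close>
  define d where "d v = (LEAST n. \<exists>r\<in>R. (v, r) \<in> ?rel ^^ n)" for v
  have d_root: "\<exists>r\<in>R. (v, r) \<in> ?rel ^^ d v" if "v \<in> V" for v
  proof -
    have "\<exists>r\<in>R. (v, r) \<in> ?rel\<^sup>*" using unique_root[OF that] by blast
    then have "\<exists>n. \<exists>r\<in>R. (v, r) \<in> ?rel ^^ n" using rtrancl_imp_relpow by metis
    then show ?thesis unfolding d_def by (rule LeastI_ex)
  qed
  have closer: "\<exists>u. {v, u} \<in> F \<and> d u < d v" if v: "v \<in> V" "v \<notin> R" for v
  proof -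
    obtain r where r: "r \<in> R" "(v, r) \<in> ?rel ^^ d v" using d_root[OF v(1)] by blast
    then have "d v \<noteq> 0" using v(2) by (metis relpow_0_E)
    then obtain m where m: "d v = Suc m" by (cases "d v") auto
    have "\<exists>u. (v, u) \<in> ?rel \<and> (u, r) \<in> ?rel ^^ m"
      using r(2) unfolding m by (rule relpow_Suc_D2)
    then obtain u where u: "{v, u} \<in> F" "(u, r) \<in> ?rel ^^ m" by blast
    have "d u \<le> m" unfolding d_def by (rule Least_le) (use u r in blast)
    then show ?thesis using u m by auto
  qed
  \<comment> \<open>Any closer neighbour will do. The restriction to \<open>V\<close> makes
    \<open>f\<close> extensional, as membership in \<open>PiE\<close> requires.\<close>
  define f where
    "f = restrict (\<lambda>v. if v \<in> R then v else SOME u. {v, u} \<in> F \<and> d u < d v) V"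
  have f_root: "f v = v" if "v \<in> R" for v using that RV by (auto simp: f_def)
  have f_step: "{v, f v} \<in> F" "d (f v) < d v" if "v \<in> V" "v \<notin> R" for v
    using someI_ex[OF closer[OF that]] that by (simp_all add: f_def)
  have f_fixed: "f v = v \<longleftrightarrow> v \<in> R" if "v \<in> V" for v
    using f_root f_step(2)[OF that] by fastforce
  have f_choice: "f v \<in> parent_choices E v" if "v \<in> V" for v
    using f_root[of v] f_step(1)[OF that] FE unfolding parent_choices_def by blast
  have maps: "f \<in> V \<rightarrow> V"
    using f_choice parent_choices_subset[OF graph] by blast
  have "f \<in> PiE V (parent_choices E)" using f_choice by (auto simp: f_def)
  moreover have ranked: "ranked V f" unfolding ranked_def using f_step(2) f_fixed by blast
  moreover have roots_eq: "parent_roots V f = R"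
    using f_fixed RV unfolding parent_roots_def by blast
  moreover have "parent_edges V f = F"
  proof
    show sub: "parent_edges V f \<subseteq> F" unfolding parent_edges_def using f_step(1) f_fixed by blast
    show "F \<subseteq> parent_edges V f"
    proof
      fix e assume e: "e \<in> F"
      then obtain x y where xy: "e = {x, y}" "x \<noteq> y" using FV(2) by (metis card_2_iff)
      then have V: "x \<in> V" "y \<in> V" using FV(1)[OF e] by auto
      obtain a where a: "(f ^^ a) x \<in> R"
        using ranked_reaches_root[OF ranked maps V(1)] roots_eq by blast
      obtain b where b: "(f ^^ b) y \<in> R"
        using ranked_reaches_root[OF ranked maps V(2)] roots_eq by blast
      have "(x, y) \<in> ?rel" using e xy by simp
      then have "(x, (f ^^ b) y) \<in> ?rel\<^sup>*"
        using funpow_connected[OF sub maps V(2)] by (rule converse_rtrancl_into_rtrancl)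
      moreover have "(x, (f ^^ a) x) \<in> ?rel\<^sup>*" using funpow_connected[OF sub maps V(1)] .
      \<comment> \<open>Both are roots in the component of \<open>x\<close>, so they coincide, and
        the parent paths from \<open>x\<close> and \<open>y\<close> meet.\<close>
      ultimately have "(f ^^ a) x = (f ^^ b) y"
        using unique_root[OF V(1)] a b RV by blast
      then show "e \<in> parent_edges V f"
        using extra_edge_closes_cycle[OF sub maps V xy(2)] acyclic e xy(1) by blast
    qed
  qed
  ultimately show ?thesis by blast
qed

section \<open>The bijection and the count of colorings\<close>

lemma bij_betw_parent_maps_rooted_forests:
  assumes graph: "simple_graph V E"
  shows "bij_betw (\<lambda>f. (parent_edges V f, parent_roots V f))
    {f \<in> PiE V (parent_choices E). ranked V f} {(F, R). spanning_forest E F \<and> root_set V F R}"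
proof -
  let ?A = "{f \<in> PiE V (parent_choices E). ranked V f}"
  have maps: "f \<in> V \<rightarrow> V" if "f \<in> ?A" for f
    using that parent_choices_subset[OF graph] by blast
  have "inj_on (\<lambda>f. (parent_edges V f, parent_roots V f)) ?A"
  proof (rule inj_onI)
    fix f g assume fg: "f \<in> ?A" "g \<in> ?A"
      and eq: "(parent_edges V f, parent_roots V f) = (parent_edges V g, parent_roots V g)"
    have "f v = g v" if "v \<in> V" for v
      by (rule parent_map_unique[of V]) (use fg eq that maps[OF fg(1)] in auto)
    then show "f = g" using fg by (auto intro: PiE_ext)
  qed
  moreover have "(parent_edges V f, parent_roots V f)
      \<in> {(F, R). spanning_forest E F \<and> root_set V F R}" if "f \<in> ?A" for f
  proof -
    have "parent_edges V f \<subseteq> E"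
      using that unfolding parent_edges_def parent_choices_def by (auto dest: PiE_mem)
    then show ?thesis
      using that root_set_parent_roots[of V f] maps[OF that] parent_edges_acyclic[of V f]
      unfolding spanning_forest_def by auto
  qed
  moreover have "p \<in> (\<lambda>f. (parent_edges V f, parent_roots V f)) ` ?A"
    if "p \<in> {(F, R). spanning_forest E F \<and> root_set V F R}" for p
    using that exists_parent_map[OF graph] by (force simp: image_iff)
  ultimately show ?thesis unfolding bij_betw_def by blast
qed

text \<open>A rooted forest with edge set \<open>F\<close> has \<open>k ^ card F\<close> colorings,
  and its edges correspond to the non-roots of its parent map. The summands are thus the
  determinants of the ranked parent maps.\<close>

lemma card_rooted_colored_spanning_forests:
  assumes graph: "simple_graph V E"
  shows "card (rooted_colored_spanning_forests V E k)
    = (\<Sum>f | f \<in> PiE V (parent_choices E) \<and> ranked V f. k ^ card {v \<in> V. f v \<noteq> v})"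
proof -
  let ?B = "{(F, R). spanning_forest E F \<and> root_set V F R}"
  have fin: "finite E" "finite V" using finite_edges graph unfolding simple_graph_def by auto
  have "?B \<subseteq> Pow E \<times> Pow V" unfolding spanning_forest_def root_set_def by auto
  then have finB: "finite ?B" by (rule finite_subset) (simp add: fin)
  have finF: "finite F" if "(F, R) \<in> ?B" for F R
    using that fin(1) finite_subset unfolding spanning_forest_def by auto
  have "bij_betw (\<lambda>((F, R), c). (F, R, c)) (SIGMA p:?B. fst p \<rightarrow>\<^sub>E {..<k})
      (rooted_colored_spanning_forests V E k)"
    by (rule bij_betw_byWitness[where f' = "\<lambda>(F, R, c). ((F, R), c)"])
      (auto simp: rooted_colored_spanning_forests_def)
  then have "card (rooted_colored_spanning_forests V E k) = card (SIGMA p:?B. fst p \<rightarrow>\<^sub>E {..<k})"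
    by (simp add: bij_betw_same_card)
  also have "\<dots> = (\<Sum>p\<in>?B. card (fst p \<rightarrow>\<^sub>E {..<k}))"
    using finB finF by (intro card_SigmaI) (auto intro!: finite_PiE)
  also have "\<dots> = (\<Sum>p\<in>?B. k ^ card (fst p))"
    using finF by (intro sum.cong) (auto simp: card_PiE)
  also have "\<dots> = (\<Sum>f | f \<in> PiE V (parent_choices E) \<and> ranked V f. k ^ card (parent_edges V f))"
    using sum.reindex_bij_betw[OF bij_betw_parent_maps_rooted_forests[OF graph],
        of "\<lambda>p. k ^ card (fst p)"] by simp
  also have "\<dots> = (\<Sum>f | f \<in> PiE V (parent_choices E) \<and> ranked V f. k ^ card {v \<in> V. f v \<noteq> v})"
    by (intro sum.cong) (auto simp: card_parent_edges)
  finally show ?thesis .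
qed

theorem theorem2:
  fixes V :: "'a set" and E :: "'a set set" and vs :: "'a list" and k :: nat
  assumes "simple_graph V E"
    and "distinct vs" and "set vs = V"
    and "k \<ge> 1"
  shows "det (1\<^sub>m (length vs) + int k \<cdot>\<^sub>m laplacian vs E)
           = int (card (rooted_colored_spanning_forests V E k))"
proof -
  let ?P = "PiE V (parent_choices E)"
  have fin: "finite ?P"
    using assms(1) finite_parent_choices[OF assms(1)]
    by (intro finite_PiE) (auto simp: simple_graph_def)
  have maps: "f \<in> V \<rightarrow> V" if "f \<in> ?P" for f
    using that parent_choices_subset[OF assms(1)] by blast
  have "det (1\<^sub>m (length vs) + int k \<cdot>\<^sub>m laplacian vs E)
      = (\<Sum>f\<in>?P. det (parent_mat vs (int k) f))"
    using assms by (intro det_one_plus_laplacian)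
  also have "\<dots> = (\<Sum>f\<in>?P. if ranked V f then int k ^ card {v \<in> V. f v \<noteq> v} else 0)"
    using det_parent_mat_ranked[OF assms(2)] det_parent_mat_not_ranked[OF assms(2)] maps assms(3)
    by (intro sum.cong) auto
  also have "\<dots> = (\<Sum>f | f \<in> ?P \<and> ranked V f. int k ^ card {v \<in> V. f v \<noteq> v})"
    using fin by (subst sum.inter_filter[symmetric]) auto
  also have "\<dots> = int (card (rooted_colored_spanning_forests V E k))"
    by (simp add: card_rooted_colored_spanning_forests[OF assms(1)])
  finally show ?thesis .
qed

end
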